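(* Let $A$ be a finite alphabet, let $\mathcal{T}=(Q,q_0,\delta,\lambda)$ be a finite inverse $\widetilde{A}$-transducer and let $z\in F_A$. Then $$L=\{g\in F_A \mid g\widetilde{\mathcal{T}}=gz\}$$ is a rational subset of the free group $F_A$.
   Context: Maps are written on the right. For a finite alphabet $A$, $A^{-1}$ is a disjoint set of formal inverses of the letters of $A$, $\widetilde{A}=A\cup A^{-1}$, and $a\mapsto a^{-1}$ is extended to an involution of the free monoid $\widetilde{A}^*$ (with $(uv)^{-1}=v^{-1}u^{-1}$). $F_A$ is the free group on $A$ and $\theta:\widetilde{A}^*\to F_A$ is the canonical morphism. A deterministic $\widetilde{A}$-transducer is $\mathcal{T}=(Q,q_0,\delta,\lambda)$ where $Q$ is a set, $q_0\in Q$, and $\delta:Q\times\widetilde{A}\to Q$, $\lambda:Q\times\widetilde{A}\to\widetilde{A}^*$ are (total) mappings; it is finite if $Q$ is finite. They are extended to $Q\times\widetilde{A}^*$ by $(q,1)\delta=q$, $(q,ua)\delta=((q,u)\delta,a)\delta$ and $(q,1)\lambda=1$, $(q,ua)\lambda=(q,u)\lambda\,\cdot\,((q,u)\delta,a)\lambda$. If $(p,a)\delta=q$ and $(p,a)\lambda=w$ we say that $p\xrightarrow{a|w}q$ is an edge of $\mathcal{T}$. $\mathcal{T}$ is inverse if: $p\xrightarrow{a|u}q$ is an edge of $\mathcal{T}$ if and only if $q\xrightarrow{a^{-1}|u^{-1}}p$ is an edge of $\mathcal{T}$ (for all $p,q\in Q$, $a\in\widetilde{A}$, $u\in\widetilde{A}^*$).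 Define $\widehat{\mathcal{T}}:\widetilde{A}^*\to\widetilde{A}^*$ by $u\widehat{\mathcal{T}}=(q_0,u)\lambda$. For inverse $\mathcal{T}$, the mapping $\widetilde{\mathcal{T}}:F_A\to F_A$ given by $(u\theta)\widetilde{\mathcal{T}}=(u\widehat{\mathcal{T}})\theta$ ($u\in\widetilde{A}^*$) is well defined. The rational subsets of a group are those obtained from finite subsets by finitely many applications of union, product and star ($X^*=\bigcup_{n\ge 0}X^n$, $X^0=\{1\}$); for $F_A$ these are exactly the images under $\theta$ of the rational languages in $\widetilde{A}^*$. *)

theory Defs
  imports "HOL-Algebra.Coset"
begin

section \<open>Words over an alphabet with formal inverses\<close>

datatype 'a letter = Pos 'a | Neg 'a

fun letter_inv :: "'a letter \<Rightarrow> 'a letter" where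
  "letter_inv (Pos a) = Neg a"
| "letter_inv (Neg a) = Pos a"

definition letters :: "'a set \<Rightarrow> 'a letter set" where
  "letters A = Pos ` A \<union> Neg ` A"

definition words :: "'a set \<Rightarrow> 'a letter list set" where
  "words A = lists (letters A)"

definition word_inv :: "'a letter list \<Rightarrow> 'a letter list" where
  "word_inv w = rev (map letter_inv w)"

lemma letter_inv_letter_inv [simp]: "letter_inv (letter_inv x) = x"
  by (cases x) auto

lemma letter_inv_in_letters [simp]: "letter_inv x \<in> letters A \<longleftrightarrow> x \<in> letters A"
  by (cases x) (auto simp: letters_def)

lemma word_inv_Nil [simp]: "word_inv [] = []"
  by (simp add: word_inv_def)

lemma word_inv_append: "word_inv (u @ v) = word_inv v @ word_inv u"
  by (simp add: word_inv_def)

lemma word_inv_word_inv [simp]: "word_inv (word_inv w) = w"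
  by (simp add: word_inv_def rev_map comp_def)

lemma words_append [simp]: "u @ v \<in> words A \<longleftrightarrow> u \<in> words A \<and> v \<in> words A"
  by (auto simp: words_def)

lemma words_Nil [simp]: "[] \<in> words A"
  by (simp add: words_def)

lemma words_Cons [simp]: "x # u \<in> words A \<longleftrightarrow> x \<in> letters A \<and> u \<in> words A"
  by (simp add: words_def)

lemma words_word_inv [simp]: "w \<in> words A \<Longrightarrow> word_inv w \<in> words A"
  by (induction w) (auto simp: word_inv_def)

section \<open>The free group on a set\<close>

text \<open>The least congruence on the free monoid \<^term>\<open>words A\<close> that identifies every
  product of a letter and its formal inverse with the empty word.\<close>

inductive_set free_cong :: "'a set \<Rightarrow> ('a letter list \<times> 'a letter list) set"
  for A :: "'a set" where
  cancel: "x \<in> letters A \<Longrightarrow> ([x, letter_inv x], []) \<in> free_cong A"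
| refl: "u \<in> words A \<Longrightarrow> (u, u) \<in> free_cong A"
| sym: "(u, v) \<in> free_cong A \<Longrightarrow> (v, u) \<in> free_cong A"
| trans: "(u, v) \<in> free_cong A \<Longrightarrow> (v, w) \<in> free_cong A \<Longrightarrow> (u, w) \<in> free_cong A"
| append: "(u, u') \<in> free_cong A \<Longrightarrow> (v, v') \<in> free_cong A \<Longrightarrow> (u @ v, u' @ v') \<in> free_cong A"

definition theta :: "'a set \<Rightarrow> 'a letter list \<Rightarrow> 'a letter list set" where
  "theta A u = free_cong A `` {u}"

definition free_group :: "'a set \<Rightarrow> 'a letter list set monoid" where
  "free_group A =
    \<lparr>carrier = words A // free_cong A,
     mult = (\<lambda>X Y. \<Union>u\<in>X. \<Union>v\<in>Y. theta A (u @ v)),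
     one = theta A []\<rparr>"

lemma free_cong_words: "(u, v) \<in> free_cong A \<Longrightarrow> u \<in> words A \<and> v \<in> words A"
  by (induction rule: free_cong.induct) auto

lemma equiv_free_cong: "equiv (words A) (free_cong A)"
proof (rule equivI)
  show "free_cong A \<subseteq> words A \<times> words A"
    using free_cong_words by auto
  show "refl_on (words A) (free_cong A)"
    by (simp add: refl_on_def free_cong.refl)
  show "sym (free_cong A)"
    by (meson free_cong.sym symI)
  show "trans (free_cong A)"
    by (meson free_cong.trans transI)
qed

lemma theta_eq_iff:
  "u \<in> words A \<Longrightarrow> v \<in> words A \<Longrightarrow> theta A u = theta A v \<longleftrightarrow> (u, v) \<in> free_cong A"
  unfolding theta_def using eq_equiv_class_iff[OF equiv_free_cong] by blast

lemma carrier_free_group: "carrier (free_group A) = theta A ` words A"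
  by (auto simp: free_group_def theta_def quotient_def)

lemma theta_mult:
  assumes "u \<in> words A" "v \<in> words A"
  shows "theta A u \<otimes>\<^bsub>free_group A\<^esub> theta A v = theta A (u @ v)"
proof -
  have "theta A (u' @ v') = theta A (u @ v)"
    if "u' \<in> theta A u" "v' \<in> theta A v" for u' v'
  proof -
    have "(u @ v, u' @ v') \<in> free_cong A"
      using that by (simp add: theta_def free_cong.append)
    then show ?thesis
      unfolding theta_def using equiv_class_eq[OF equiv_free_cong] by blast
  qed
  moreover have "u \<in> theta A u" "v \<in> theta A v"
    using assms by (simp_all add: theta_def free_cong.refl)
  ultimately have "(\<Union>u'\<in>theta A u. \<Union>v'\<in>theta A v. theta A (u' @ v')) = theta A (u @ v)"
    by blast
  then show ?thesis
    by (simp add: free_group_def)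
qed

lemma theta_one: "\<one>\<^bsub>free_group A\<^esub> = theta A []"
  by (simp add: free_group_def)

lemma free_cong_word_inv:
  "w \<in> words A \<Longrightarrow> (w @ word_inv w, []) \<in> free_cong A"
proof (induction w)
  case Nil
  then show ?case by (simp add: free_cong.refl)
next
  case (Cons x w)
  then have x: "x \<in> letters A" and "(w @ word_inv w, []) \<in> free_cong A"
    by auto
  then have "([x] @ (w @ word_inv w) @ [letter_inv x], [x] @ [] @ [letter_inv x]) \<in> free_cong A"
    by (intro free_cong.append free_cong.refl) auto
  then have "([x] @ (w @ word_inv w) @ [letter_inv x], []) \<in> free_cong A"
    using free_cong.cancel[OF x] free_cong.trans by fastforce
  then show ?case
    by (simp add: word_inv_def)
qed

lemma group_free_group: "group (free_group A)"
proof (rule groupI)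
  fix x assume "x \<in> carrier (free_group A)"
  then obtain u where u: "u \<in> words A" "x = theta A u"
    by (auto simp: carrier_free_group)
  have "(word_inv u @ u, []) \<in> free_cong A"
    using free_cong_word_inv[of "word_inv u" A] u by simp
  then have "theta A (word_inv u) \<otimes>\<^bsub>free_group A\<^esub> x = \<one>\<^bsub>free_group A\<^esub>"
    using u by (simp add: theta_mult theta_one theta_eq_iff)
  then show "\<exists>y\<in>carrier (free_group A). y \<otimes>\<^bsub>free_group A\<^esub> x = \<one>\<^bsub>free_group A\<^esub>"
    using u by (auto simp: carrier_free_group)
next
  fix x y assume "x \<in> carrier (free_group A)" "y \<in> carrier (free_group A)"
  then show "x \<otimes>\<^bsub>free_group A\<^esub> y \<in> carrier (free_group A)"
    unfolding carrier_free_group by (elim imageE) (simp add: theta_mult)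
next
  show "\<one>\<^bsub>free_group A\<^esub> \<in> carrier (free_group A)"
    by (simp add: carrier_free_group theta_one)
next
  fix x y z
  assume "x \<in> carrier (free_group A)" "y \<in> carrier (free_group A)" "z \<in> carrier (free_group A)"
  then show "x \<otimes>\<^bsub>free_group A\<^esub> y \<otimes>\<^bsub>free_group A\<^esub> z =
      x \<otimes>\<^bsub>free_group A\<^esub> (y \<otimes>\<^bsub>free_group A\<^esub> z)"
    unfolding carrier_free_group by (elim imageE) (simp add: theta_mult)
next
  fix x assume "x \<in> carrier (free_group A)"
  then show "\<one>\<^bsub>free_group A\<^esub> \<otimes>\<^bsub>free_group A\<^esub> x = x"
    unfolding carrier_free_group by (elim imageE) (simp add: theta_mult theta_one)
qed

section \<open>Rational subsets\<close>

primrec set_power :: "('g, 'b) monoid_scheme \<Rightarrow> 'g set \<Rightarrow> nat \<Rightarrow> 'g set" where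
  "set_power G X 0 = {\<one>\<^bsub>G\<^esub>}"
| "set_power G X (Suc n) = set_power G X n <#>\<^bsub>G\<^esub> X"

definition set_star :: "('g, 'b) monoid_scheme \<Rightarrow> 'g set \<Rightarrow> 'g set" where
  "set_star G X = (\<Union>n. set_power G X n)"

inductive_set rational_subsets :: "('g, 'b) monoid_scheme \<Rightarrow> 'g set set"
  for G :: "('g, 'b) monoid_scheme" where
  finite: "finite X \<Longrightarrow> X \<subseteq> carrier G \<Longrightarrow> X \<in> rational_subsets G"
| union: "X \<in> rational_subsets G \<Longrightarrow> Y \<in> rational_subsets G \<Longrightarrow> X \<union> Y \<in> rational_subsets G"
| product: "X \<in> rational_subsets G \<Longrightarrow> Y \<in> rational_subsets G \<Longrightarrow> X <#>\<^bsub>G\<^esub> Y \<in> rational_subsets G"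
| star: "X \<in> rational_subsets G \<Longrightarrow> set_star G X \<in> rational_subsets G"

section \<open>Inverse transducers\<close>

record ('q, 'a) transducer =
  states :: "'q set"
  start :: 'q
  step :: "'q \<Rightarrow> 'a letter \<Rightarrow> 'q"
  out :: "'q \<Rightarrow> 'a letter \<Rightarrow> 'a letter list"

text \<open>Only the values of \<^const>\<open>step\<close> and \<^const>\<open>out\<close> at states in \<^const>\<open>states\<close> and letters
  in \<^term>\<open>letters A\<close> are meaningful.\<close>

definition transducer :: "'a set \<Rightarrow> ('q, 'a) transducer \<Rightarrow> bool" where
  "transducer A T \<longleftrightarrow>
    start T \<in> states T \<and>
    (\<forall>q\<in>states T. \<forall>a\<in>letters A. step T q a \<in> states T \<and> out T q a \<in> words A)"

definition edge ::
  "('q, 'a) transducer \<Rightarrow> 'q \<Rightarrow> 'a letter \<Rightarrow> 'a letter list \<Rightarrow> 'q \<Rightarrow> bool" where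
  "edge T p a w q \<longleftrightarrow> step T p a = q \<and> out T p a = w"

definition inverse_transducer :: "'a set \<Rightarrow> ('q, 'a) transducer \<Rightarrow> bool" where
  "inverse_transducer A T \<longleftrightarrow>
    transducer A T \<and>
    (\<forall>p\<in>states T. \<forall>q\<in>states T. \<forall>a\<in>letters A. \<forall>u\<in>words A.
      edge T p a u q \<longleftrightarrow> edge T q (letter_inv a) (word_inv u) p)"

definition steps :: "('q, 'a) transducer \<Rightarrow> 'q \<Rightarrow> 'a letter list \<Rightarrow> 'q" where
  "steps T q u = foldl (step T) q u"

fun outs :: "('q, 'a) transducer \<Rightarrow> 'q \<Rightarrow> 'a letter list \<Rightarrow> 'a letter list" where
  "outs T q [] = []"
| "outs T q (a # u) = out T q a @ outs T (step T q a) u"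

lemma steps_snoc:
  "steps T q [] = q"
  "steps T q (u @ [a]) = step T (steps T q u) a"
  by (simp_all add: steps_def)

lemma steps_append: "steps T q (u @ v) = steps T (steps T q u) v"
  by (simp add: steps_def)

lemma outs_append: "outs T q (u @ v) = outs T q u @ outs T (steps T q u) v"
  by (induction u arbitrary: q) (auto simp: steps_def)

lemma outs_snoc: "outs T q (u @ [a]) = outs T q u @ out T (steps T q u) a"
  by (simp add: outs_append)

definition word_map :: "('q, 'a) transducer \<Rightarrow> 'a letter list \<Rightarrow> 'a letter list" where
  "word_map T u = outs T (start T) u"

text \<open>The images of all representatives of \<^term>\<open>g\<close> lie in one class when the transducer is
  inverse, so the union below is that class; see \<open>group_map_theta\<close>.\<close>

definition group_map ::
  "'a set \<Rightarrow> ('q, 'a) transducer \<Rightarrow> 'a letter list set \<Rightarrow> 'a letter list set" where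
  "group_map A T g = (\<Union>u\<in>g. theta A (word_map T u))"

lemma steps_outs_closed:
  assumes "transducer A T"
  shows "q \<in> states T \<Longrightarrow> u \<in> words A \<Longrightarrow> steps T q u \<in> states T \<and> outs T q u \<in> words A"
  using assms
  by (induction u arbitrary: q) (auto simp: steps_def transducer_def)

lemma word_map_closed:
  "transducer A T \<Longrightarrow> u \<in> words A \<Longrightarrow> word_map T u \<in> words A"
  using steps_outs_closed[of A T "start T" u] by (auto simp: word_map_def transducer_def)

lemma free_cong_transducer:
  assumes inv: "inverse_transducer A T"
  shows "(u, v) \<in> free_cong A \<Longrightarrow> q \<in> states T \<Longrightarrow>
    steps T q u = steps T q v \<and> (outs T q u, outs T q v) \<in> free_cong A"
proof (induction arbitrary: q rule: free_cong.induct)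
  case (cancel x)
  have tr: "transducer A T"
    using inv by (simp add: inverse_transducer_def)
  define p where "p = step T q x"
  have w: "out T q x \<in> words A" "p \<in> states T"
    using tr cancel by (auto simp: transducer_def p_def)
  have "edge T p (letter_inv x) (word_inv (out T q x)) q"
    using inv cancel w unfolding inverse_transducer_def
    by (metis edge_def p_def)
  then have "steps T q [x, letter_inv x] = q"
    "outs T q [x, letter_inv x] = out T q x @ word_inv (out T q x)"
    by (auto simp: edge_def steps_def p_def)
  then show ?case
    using free_cong_word_inv[OF w(1)] by (simp add: steps_def)
next
  case (refl u)
  then show ?case
    using inv steps_outs_closed[of A T q u]
    by (simp add: inverse_transducer_def free_cong.refl)
next
  case (sym u v)
  then show ?case by (simp add: free_cong.sym)
next
  case (trans u v w)
  show ?case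
    using trans.IH(1)[OF trans.prems] trans.IH(2)[OF trans.prems] free_cong.trans
    by fastforce
next
  case (append u u' v v')
  have "steps T q u \<in> states T"
    using steps_outs_closed[of A T q u] inv append.prems free_cong_words[OF append.hyps(1)]
    by (simp add: inverse_transducer_def)
  then show ?case
    using append.IH(1)[OF append.prems] append.IH(2)
    by (simp add: steps_append outs_append free_cong.append)
qed

lemma group_map_theta:
  assumes inv: "inverse_transducer A T" and u: "u \<in> words A"
  shows "group_map A T (theta A u) = theta A (word_map T u)"
proof -
  have "theta A (word_map T v) = theta A (word_map T u)" if "v \<in> theta A u" for v
  proof -
    have "(outs T (start T) u, outs T (start T) v) \<in> free_cong A"
      using that free_cong_transducer[OF inv] inv
      by (auto simp: theta_def inverse_transducer_def transducer_def)
    then show ?thesis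
      unfolding theta_def word_map_def using equiv_class_eq[OF equiv_free_cong] by blast
  qed
  moreover have "u \<in> theta A u"
    using u by (simp add: theta_def free_cong.refl)
  ultimately show ?thesis
    unfolding group_map_def by blast
qed

end

theory Submission
  imports Defs
begin

text \<open>The free group acts on the right on \<open>F\<^sub>A \<times> Q\<close> by
  \<open>(h, q) \<cdot> g = (g\<^sup>-\<^sup>1 h (q, g)\<lambda>, (q, g)\<delta>)\<close>, and \<open>L\<close> consists of the \<open>g\<close> moving \<open>(1, q\<^sub>0)\<close> into
  \<open>{z} \<times> Q\<close>, so \<open>L\<close> is a finite union of cosets of the stabiliser of \<open>(1, q\<^sub>0)\<close>. The stabiliser is
  finitely generated by an argument of Goldstein and Turner: let the vertex \<open>(h, q)\<close> of the
  Schreier graph point along the first letter of the reduced form of \<open>h\<close>. Since outputs of letters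
  have bounded length, all but finitely many edges are pointed along by one of their two ends, and
  hence the part of the graph carrying its fundamental group is finite.\<close>

section \<open>Stabilisers in a right action with a flow\<close>

lemma (in group) set_star_one: "\<one> \<in> set_star G Y"
  unfolding set_star_def by (rule UN_I[of 0]) auto

lemma (in group) set_star_mult:
  "h \<in> set_star G Y \<Longrightarrow> y \<in> Y \<Longrightarrow> h \<otimes> y \<in> set_star G Y"
  unfolding set_star_def by (force simp: set_mult_def intro: exI[of _ "Suc _"])

lemma (in group) set_star_induct [consumes 2, case_names one mult]:
  assumes "g \<in> set_star G B" "B \<subseteq> carrier G"
    and one: "P \<one>"
    and mult: "\<And>g b. g \<in> carrier G \<Longrightarrow> b \<in> B \<Longrightarrow> P g \<Longrightarrow> P (g \<otimes> b)"
  shows "P g"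
proof -
  have "set_power G B n \<subseteq> {g \<in> carrier G. P g}" for n
    by (induction n) (use assms in \<open>auto simp: set_mult_def\<close>)
  then show ?thesis
    using assms(1) by (auto simp: set_star_def)
qed

lemma (in group) set_star_subset_subgroup:
  assumes "subgroup H G" "Y \<subseteq> H"
  shows "set_star G Y \<subseteq> H"
proof
  have Y: "Y \<subseteq> carrier G"
    using assms subgroup.subset by blast
  fix g assume "g \<in> set_star G Y"
  from this Y show "g \<in> H"
    by (induction rule: set_star_induct)
      (use assms in \<open>auto intro: subgroup.one_closed subgroup.m_closed\<close>)
qed

section \<open>Right actions, stabilisers and transporters\<close>

locale right_action = group G for G (structure) +
  fixes X :: "'x set" and act :: "'x \<Rightarrow> 'a \<Rightarrow> 'x"
  assumes act_closed [simp]: "x \<in> X \<Longrightarrow> g \<in> carrier G \<Longrightarrow> act x g \<in> X"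
    and act_one [simp]: "x \<in> X \<Longrightarrow> act x \<one> = x"
    and act_mult: "x \<in> X \<Longrightarrow> g \<in> carrier G \<Longrightarrow> h \<in> carrier G \<Longrightarrow> act x (g \<otimes> h) = act (act x g) h"
begin

lemma act_inv:
  "x \<in> X \<Longrightarrow> g \<in> carrier G \<Longrightarrow> act x g = y \<Longrightarrow> act y (inv g) = x"
  using act_mult[of x g "inv g"] by auto

definition stab :: "'x \<Rightarrow> 'a set" where
  "stab s = {g \<in> carrier G. act s g = s}"

lemma subgroup_stab:
  assumes "s \<in> X"
  shows "subgroup (stab s) G"
  by (rule subgroupI) (use assms in \<open>auto simp: stab_def act_mult act_inv intro: exI[of _ \<one>]\<close>)

text \<open>Right multiplication by \<open>inv c\<close> carries such a \<open>g\<close> into the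
  stabiliser.\<close>

lemma transporter_eq_coset:
  assumes "s \<in> X" "c \<in> carrier G"
  shows "{g \<in> carrier G. act s g = act s c} = stab s <#> {c}"
proof (intro equalityI subsetI)
  fix g assume g: "g \<in> {g \<in> carrier G. act s g = act s c}"
  then have "g \<otimes> inv c \<in> stab s"
    using assms act_inv[of s c] by (auto simp: stab_def act_mult)
  moreover have "g = (g \<otimes> inv c) \<otimes> c"
    using g assms by (simp add: m_assoc)
  ultimately show "g \<in> stab s <#> {c}"
    unfolding set_mult_def by blast
qed (use assms in \<open>auto simp: set_mult_def stab_def act_mult\<close>)

end

section \<open>Flows on an action and links between their trajectories\<close>

locale flow = right_action G X act for G (structure) and X :: "'x set" and act +
  fixes dir :: "'x \<Rightarrow> 'a"
  assumes dir_closed [simp]: "x \<in> X \<Longrightarrow> dir x \<in> carrier G"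
begin

text \<open>The direction \<one> makes \<open>x\<close> a rest point of the flow.\<close>

definition succ :: "'x \<Rightarrow> 'x" where
  "succ x = act x (dir x)"

fun trace :: "'x \<Rightarrow> nat \<Rightarrow> 'a" where
  "trace x 0 = \<one>"
| "trace x (Suc n) = dir x \<otimes> trace (succ x) n"

text \<open>Each point has only one outgoing flow step, so a forward step after a backward one
  merely backtracks. Hence every path of flow edges reduces to this shape: forward from
  \<open>p\<close>, then backward to \<open>q\<close>.\<close>

definition links :: "'x \<Rightarrow> 'x \<Rightarrow> 'a set" where
  "links p q = {trace p i \<otimes> inv (trace q j) | i j. (succ ^^ i) p = (succ ^^ j) q}"

lemma succ_closed [simp]: "x \<in> X \<Longrightarrow> succ x \<in> X"
  by (simp add: succ_def)

lemma funpow_succ_closed [simp]: "x \<in> X \<Longrightarrow> (succ ^^ n) x \<in> X"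
  by (induction n) auto

lemma trace_closed [simp]: "x \<in> X \<Longrightarrow> trace x n \<in> carrier G"
  by (induction n arbitrary: x) auto

lemma act_trace: "x \<in> X \<Longrightarrow> act x (trace x n) = (succ ^^ n) x"
  by (induction n arbitrary: x) (auto simp: act_mult funpow_swap1 simp flip: succ_def)

lemma trace_add:
  "x \<in> X \<Longrightarrow> trace x (m + n) = trace x m \<otimes> trace ((succ ^^ m) x) n"
  by (induction m arbitrary: x) (auto simp: m_assoc funpow_swap1)

text \<open>Beyond the meeting point both trajectories coincide, so the common tail cancels.\<close>

lemma link_shift:
  assumes "p \<in> X" "q \<in> X" "(succ ^^ i) p = (succ ^^ j) q"
  shows "trace p (i + k) \<otimes> inv (trace q (j + k)) = trace p i \<otimes> inv (trace q j)"
  using assms by (simp add: trace_add inv_mult_group m_assoc inv_solve_left' flip: m_assoc)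
    (simp add: m_assoc)

lemma links_closed: "p \<in> X \<Longrightarrow> q \<in> X \<Longrightarrow> k \<in> links p q \<Longrightarrow> k \<in> carrier G"
  by (auto simp: links_def)

lemma act_links:
  assumes "p \<in> X" "q \<in> X" "k \<in> links p q"
  shows "act p k = q"
proof -
  obtain i j where "k = trace p i \<otimes> inv (trace q j)" "(succ ^^ i) p = (succ ^^ j) q"
    using assms by (auto simp: links_def)
  then show ?thesis
    using assms act_inv[of q "trace q j"] by (simp add: act_mult act_trace)
qed

text \<open>On an infinite forward orbit all meeting points with another orbit differ by a common shift,
  so they all give the same link.\<close>

lemma finite_links:
  assumes p: "p \<in> X" "dir p = \<one> \<or> inj (\<lambda>n. (succ ^^ n) p)"
    and q: "q \<in> X" "dir q = \<one> \<or> inj (\<lambda>n. (succ ^^ n) q)"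
  shows "finite (links p q)"
proof -
  have fixed: "(succ ^^ n) x = x" "trace x n = \<one>" if "x \<in> X" "dir x = \<one>" for x n
  proof -
    have "succ x = x" using that by (simp add: succ_def)
    then show "(succ ^^ n) x = x" by (induction n) auto
    show "trace x n = \<one>" using that \<open>succ x = x\<close> by (induction n) auto
  qed
  \<comment> \<open>A trajectory that reaches a rest point stays there, so it is not
    injective.\<close>
  have no: "(succ ^^ n) y \<noteq> x"
    if "x \<in> X" "dir x = \<one>" "inj (\<lambda>n. (succ ^^ n) y)" for x y n
  proof
    assume "(succ ^^ n) y = x"
    then have "(succ ^^ Suc n) y = (succ ^^ n) y"
      using fixed(1)[OF that(1,2), of 1] by simp
    then have "Suc n = n"
      using that(3) unfolding inj_def by blast
    then show False by simp
  qed
  \<comment> \<open>Any two links coincide, so there is at most one.\<close>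
  have uniq: "trace p i \<otimes> inv (trace q j) = trace p i' \<otimes> inv (trace q j')"
    if "(succ ^^ i) p = (succ ^^ j) q" "(succ ^^ i') p = (succ ^^ j') q" "i \<le> i'" for i j i' j'
  proof (cases "dir p = \<one>")
    case True
    then have "dir q = \<one>"
      using q no[OF p(1) True] that(1) fixed(1)[OF p(1) True] by metis
    then show ?thesis
      using True p q by (simp add: fixed)
  next
    case False
    then have ip: "inj (\<lambda>n. (succ ^^ n) p)" using p by simp
    then have iq: "inj (\<lambda>n. (succ ^^ n) q)"
      using q no[OF q(1) _ ip] that(1) fixed(1)[OF q(1)] by metis
    define k where "k = i' - i"
    have i': "i' = i + k" using that by (simp add: k_def)
    \<comment> \<open>Shifting the first meeting by \<open>k\<close> gives another one at
      \<open>i'\<close>; injectivity along \<open>q\<close> then forces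
      \<open>j' = j + k\<close>.\<close>
    have "(succ ^^ i') p = (succ ^^ (j + k)) q"
      using that(1) by (simp add: i' funpow_add add.commute[of _ k])
    then have "j' = j + k"
      using iq that(2) unfolding inj_def by metis
    then show ?thesis
      using link_shift[OF p(1) q(1) that(1)] i' by simp
  qed
  have "a = b" if ab: "a \<in> links p q" "b \<in> links p q" for a b
  proof -
    obtain i j where "a = trace p i \<otimes> inv (trace q j)" "(succ ^^ i) p = (succ ^^ j) q"
      using ab(1) unfolding links_def by blast
    moreover obtain i' j' where
      "b = trace p i' \<otimes> inv (trace q j')" "(succ ^^ i') p = (succ ^^ j') q"
      using ab(2) unfolding links_def by blast
    ultimately show ?thesis
      using uniq[of i j i' j'] uniq[of i' j' i j] by (cases "i \<le> i'") auto
  qed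
  then have "links p q \<subseteq> {a}" if "a \<in> links p q" for a
    using that by blast
  then show ?thesis
    by (metis ex_in_conv finite.emptyI finite_insert finite_subset)
qed

text \<open>A Reidemeister-Schreier argument. A product of elements of \<open>B\<close> traces a
  path from \<open>s\<close>; cutting it at the exceptional edges leaves links, and chosen
  transporters close the pieces up to loops at \<open>s\<close>. The pieces are only multiplied,
  never inverted, so the star of \<open>Y\<close> suffices.\<close>

lemma stab_eq_set_star_if_finite_links:
  assumes B: "finite B" "B \<subseteq> carrier G"
    and gen: "carrier G \<subseteq> set_star G B"
    and S: "finite S" "S \<subseteq> X" "s \<in> S"
    and edges: "\<And>x b. x \<in> X \<Longrightarrow> b \<in> B \<Longrightarrow>
      b = dir x \<or> inv b = dir (act x b) \<or> (x \<in> S \<and> act x b \<in> S)"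
    and fin: "\<And>p q. p \<in> S \<Longrightarrow> q \<in> S \<Longrightarrow> finite (links p q)"
  obtains Y where "finite Y" "Y \<subseteq> carrier G" "stab s = set_star G Y"
proof -
  \<comment> \<open>Transporters from \<open>s\<close>, with \<open>c s\<close> set to \<one> so
    that nothing remains to be removed when a path returns to \<open>s\<close>.\<close>
  define c where "c p = (if p = s then \<one> else SOME g. g \<in> carrier G \<and> act s g = p)" for p
  define R where "R = {p \<in> S. \<exists>g\<in>carrier G. act s g = p}"
  have sX: "s \<in> X" using S by auto
  have RX: "p \<in> X" if "p \<in> R" for p using that S by (auto simp: R_def)
  have c: "c p \<in> carrier G" "act s (c p) = p" if "p \<in> R" for p
  proof -
    have "\<exists>g. g \<in> carrier G \<and> act s g = p" using that by (auto simp: R_def)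
    from someI_ex[OF this] show "c p \<in> carrier G" "act s (c p) = p"
      using sX by (auto simp: c_def)
  qed
  have cs: "c s = \<one>" "s \<in> R"
    using S sX act_one[OF sX] by (auto simp: c_def R_def intro!: bexI[of _ \<one>])
  \<comment> \<open>Schreier-type generators: loops at \<open>s\<close> through one link or one edge
    between exceptional points.\<close>
  define Y where
    "Y = (\<Union>p\<in>R. \<Union>q\<in>R. (\<lambda>k. c p \<otimes> k \<otimes> inv (c q)) ` (links p q \<union> {b \<in> B. act p b = q}))"
  have "finite R" using S by (simp add: R_def)
  then have "finite Y"
    unfolding Y_def using B fin by (intro finite_UN_I finite_imageI finite_UnI) (auto simp: R_def)
  have Ystab: "Y \<subseteq> stab s"
  proof
    fix y assume "y \<in> Y"
    then obtain p q k where pq: "p \<in> R" "q \<in> R" and y: "y = c p \<otimes> k \<otimes> inv (c q)"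
      and k: "k \<in> links p q \<union> {b \<in> B. act p b = q}"
      unfolding Y_def by blast
    have "k \<in> carrier G" "act p k = q"
      using k pq RX B links_closed act_links by blast+
    then show "y \<in> stab s"
      using c[OF pq(1)] c[OF pq(2)] sX act_inv[OF sX, of "c q" q]
      by (simp add: y stab_def act_mult)
  qed
  \<comment> \<open>Invariant along a product: a finished part \<open>h\<close>, then an exceptional
    point \<open>p\<close> from which the rest is a link still open at its end
    \<open>act s g\<close>.\<close>
  define I where "I g \<longleftrightarrow> (\<exists>h p i j. h \<in> set_star G Y \<and> p \<in> R \<and>
    (succ ^^ i) p = (succ ^^ j) (act s g) \<and>
    g = h \<otimes> (c p \<otimes> (trace p i \<otimes> inv (trace (act s g) j))))" for g
  have star: "set_star G Y \<subseteq> stab s"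
    using set_star_subset_subgroup[OF subgroup_stab[OF sX] Ystab] .
  have starc: "h \<in> carrier G" if "h \<in> set_star G Y" for h
    using that star by (auto simp: stab_def)
  \<comment> \<open>Once the end point is exceptional, the open link becomes a generator in
    \<open>Y\<close> followed by a transporter.\<close>
  have close: "\<exists>h'\<in>set_star G Y. g = h' \<otimes> c (act s g)"
    if g: "g \<in> carrier G" "I g" "act s g \<in> S" for g
  proof -
    let ?x = "act s g"
    obtain h p i j where *: "h \<in> set_star G Y" "p \<in> R"
      "(succ ^^ i) p = (succ ^^ j) ?x"
      "g = h \<otimes> (c p \<otimes> (trace p i \<otimes> inv (trace ?x j)))"
      using g(2) unfolding I_def by blast
    let ?k = "trace p i \<otimes> inv (trace ?x j)"
    have xR: "?x \<in> R" using g by (auto simp: R_def)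
    have kl: "?k \<in> links p ?x" using *(3) by (auto simp: links_def)
    then have "c p \<otimes> ?k \<otimes> inv (c ?x) \<in> Y"
      unfolding Y_def using *(2) xR by blast
    then have "h \<otimes> (c p \<otimes> ?k \<otimes> inv (c ?x)) \<in> set_star G Y"
      using * set_star_mult by blast
    moreover have "h \<otimes> (c p \<otimes> k \<otimes> inv (c ?x)) \<otimes> c ?x = h \<otimes> (c p \<otimes> k)"
      if "k \<in> carrier G" for k
      using that c[OF *(2)] c[OF xR] starc[OF *(1)] by (simp add: m_assoc)
    then have "g = h \<otimes> (c p \<otimes> ?k \<otimes> inv (c ?x)) \<otimes> c ?x"
      using *(4) links_closed[OF RX[OF *(2)] RX[OF xR] kl] by simp
    ultimately show ?thesis by blast
  qed
  have I: "I g" if "g \<in> set_star G B" for g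
    using that B(2)
  proof (induction rule: set_star_induct)
    case one
    show ?case
      unfolding I_def using sX cs set_star_one
      by (intro exI[of _ \<one>] exI[of _ s] exI[of _ 0]) auto
  next
    case (mult g b)
    note g = mult(1) and b = mult(2) and Ig = mult(3)
    define x where "x = act s g"
    define y where "y = act x b"
    have bc: "b \<in> carrier G" using b B by auto
    have y: "act s (g \<otimes> b) = y" using g bc sX by (simp add: act_mult x_def y_def)
    have xX: "x \<in> X" "y \<in> X" using g bc sX by (auto simp: x_def y_def)
    obtain h p i j where *: "h \<in> set_star G Y" "p \<in> R"
      "(succ ^^ i) p = (succ ^^ j) x"
      "g = h \<otimes> (c p \<otimes> (trace p i \<otimes> inv (trace x j)))"
      using Ig unfolding I_def x_def by blast
    note cl = starc[OF *(1)] c(1)[OF *(2)] RX[OF *(2)]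
    have assoc: "(h \<otimes> (c p \<otimes> (t \<otimes> r))) \<otimes> b = h \<otimes> (c p \<otimes> (t \<otimes> (r \<otimes> b)))"
      if "t \<in> carrier G" "r \<in> carrier G" for t r
      using that cl bc by (simp add: m_assoc)
    consider "b = dir x" | "inv b = dir y" | "x \<in> S" "y \<in> S"
      using edges[OF xX(1) b] by (auto simp: y_def)
    then show "I (g \<otimes> b)"
    proof cases
      case 1
      \<comment> \<open>Here \<open>b\<close> is a forward step. Lengthening both trajectories by
        one lets the backward part end with the step from \<open>succ x\<close> to \<open>x\<close>,
        which \<open>b\<close> cancels; this also covers \<open>j = 0\<close>.\<close>
      have yx: "y = succ x" using 1 by (simp add: y_def succ_def)
      have "(succ ^^ Suc i) p = (succ ^^ j) y"
        using *(3) by (simp add: yx funpow_swap1)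
      moreover have "g = h \<otimes> (c p \<otimes> (trace p (Suc i) \<otimes> inv (trace x (Suc j))))"
        using *(4) link_shift[OF cl(3) xX(1) *(3), of 1] by simp
      then have "g \<otimes> b = h \<otimes> (c p \<otimes> (trace p (Suc i) \<otimes> (inv (trace x (Suc j)) \<otimes> b)))"
        using assoc[of "trace p (Suc i)" "inv (trace x (Suc j))"] xX cl
        by (simp del: trace.simps)
      moreover have "inv (trace x (Suc j)) \<otimes> b = inv (trace y j)"
        using xX bc by (simp add: yx inv_mult_group m_assoc 1)
      ultimately show ?thesis
        unfolding I_def y using *(1,2) by metis
    next
      case 2
      \<comment> \<open>Here \<open>b\<close> runs backward along the flow step of \<open>y\<close>,
        so the backward part grows by one.\<close>
      have xy: "x = succ y"
        using act_inv[OF xX(1) bc y_def[symmetric]] 2 by (simp add: succ_def)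
      have "(succ ^^ i) p = (succ ^^ Suc j) y"
        using *(3) by (simp add: xy funpow_swap1)
      moreover have "g \<otimes> b = h \<otimes> (c p \<otimes> (trace p i \<otimes> (inv (trace x j) \<otimes> b)))"
        using assoc[of "trace p i" "inv (trace x j)"] xX cl *(4) by simp
      moreover have "inv (trace x j) \<otimes> b = inv (trace y (Suc j))"
        using xX bc by (simp add: xy inv_mult_group flip: 2)
      ultimately show ?thesis
        unfolding I_def y using *(1,2) by metis
    next
      case 3
      \<comment> \<open>At an exceptional edge the link is closed at \<open>x\<close>, the edge is
        used as a generator, and an empty link starts at \<open>y\<close>.\<close>
      obtain h' where h': "h' \<in> set_star G Y" "g = h' \<otimes> c x"
        using close[OF g Ig] 3 unfolding x_def by blast
      have R: "x \<in> R" "y \<in> R"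
        using 3 g m_closed[OF g bc] y x_def unfolding R_def by blast+
      have "c x \<otimes> b \<otimes> inv (c y) \<in> Y"
        unfolding Y_def using R b y_def by blast
      then have "h' \<otimes> (c x \<otimes> b \<otimes> inv (c y)) \<in> set_star G Y"
        using h' set_star_mult by blast
      moreover have "g \<otimes> b = h' \<otimes> (c x \<otimes> b \<otimes> inv (c y)) \<otimes> (c y \<otimes> (trace y 0 \<otimes> inv (trace y 0)))"
        using h' starc[OF h'(1)] c[OF R(1)] c[OF R(2)] bc by (simp add: m_assoc)
      ultimately show ?thesis
        unfolding I_def y using R(2) by blast
    qed
  qed
  have "stab s \<subseteq> set_star G Y"
  proof
    fix g assume "g \<in> stab s"
    then have g: "g \<in> carrier G" "act s g = s" by (auto simp: stab_def)
    then show "g \<in> set_star G Y"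
      using close[OF g(1) I] g gen cs S starc by auto
  qed
  then show thesis
    using that[OF \<open>finite Y\<close>] star Ystab by (auto simp: stab_def)
qed

text \<open>The flow is stopped on the finitely many finite orbits that start in the exceptional set; their
  edges become exceptional instead.\<close>

lemma stab_rational:
  assumes B: "finite B" "B \<subseteq> carrier G"
    and gen: "carrier G \<subseteq> set_star G B"
    and S: "finite S" "S \<subseteq> X"
    and edges: "\<And>x b. x \<in> X \<Longrightarrow> b \<in> B \<Longrightarrow>
      b = dir x \<or> inv b = dir (act x b) \<or> (x \<in> S \<and> act x b \<in> S)"
    and s: "s \<in> X"
  shows "stab s \<in> rational_subsets G"
proof -
  define orb where "orb x = range (\<lambda>n. (succ ^^ n) x)" for x
  \<comment> \<open>On a finite trajectory links could wind around a cycle arbitrarily often, so the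
    flow is made to rest there.\<close>
  define C where "C = (\<Union>p\<in>{p \<in> insert s S. finite (orb p)}. orb p)"
  define S' where "S' = insert s S \<union> C"
  have C: "finite C" "C \<subseteq> X"
    using S s by (auto simp: C_def orb_def)
  have succC: "succ x \<in> C" if x: "x \<in> C" for x
  proof -
    obtain p n where "p \<in> insert s S" "finite (orb p)" "x = (succ ^^ n) p"
      using x unfolding C_def orb_def by blast
    moreover from this have "succ x \<in> orb p"
      unfolding orb_def by (auto intro: range_eqI[of _ _ "Suc n"])
    ultimately show ?thesis unfolding C_def by blast
  qed
  interpret F: flow G X act "\<lambda>x. if x \<in> C then \<one> else dir x"
    by unfold_locales auto
  \<comment> \<open>A repetition makes the trajectory eventually periodic, hence finite.\<close>
  have inj: "inj (\<lambda>n. (succ ^^ n) x)" if "infinite (orb x)" for x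
  proof (rule ccontr)
    assume "\<not> inj (\<lambda>n. (succ ^^ n) x)"
    then obtain m n where "(succ ^^ m) x = (succ ^^ n) x" "m < n"
      unfolding inj_def by (metis linorder_neqE_nat)
    define y where "y = (succ ^^ m) x"
    have per: "(succ ^^ (n - m)) y = y"
      using \<open>m < n\<close> \<open>(succ ^^ m) x = (succ ^^ n) x\<close> unfolding y_def
      by (metis comp_apply funpow_add le_add_diff_inverse2 less_imp_le)
    have "(succ ^^ k) x \<in> (\<lambda>k. (succ ^^ k) x) ` {..<n}" for k
    proof (cases "k < m")
      case False
      then have "(succ ^^ k) x = (succ ^^ (k - m)) y"
        unfolding y_def by (metis comp_apply funpow_add le_add_diff_inverse2 not_less)
      also have "\<dots> = (succ ^^ ((k - m) mod (n - m))) y"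
        using funpow_mod_eq[OF per] by simp
      also have "\<dots> = (succ ^^ ((k - m) mod (n - m) + m)) x"
        by (simp add: y_def funpow_add)
      finally have "(succ ^^ k) x = (succ ^^ ((k - m) mod (n - m) + m)) x" .
      moreover have "(k - m) mod (n - m) < n - m"
        using \<open>m < n\<close> by simp
      then have "(k - m) mod (n - m) + m < n"
        by linarith
      ultimately show ?thesis by blast
    qed (use \<open>m < n\<close> in auto)
    then have "orb x \<subseteq> (\<lambda>k. (succ ^^ k) x) ` {..<n}"
      by (auto simp: orb_def)
    then show False
      using that finite_subset by blast
  qed
  have stop: "(if p \<in> C then \<one> else dir p) = \<one> \<or> inj (\<lambda>n. (F.succ ^^ n) p)" if "p \<in> S'" for p
  proof (cases "p \<in> C")
    case False
    have "p \<in> orb p"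
      unfolding orb_def by (rule range_eqI[of _ _ 0]) simp
    then have inf: "infinite (orb p)" "p \<in> X"
      using False that S s by (auto simp: S'_def C_def)
    \<comment> \<open>\<open>C\<close> is finite and closed under \<open>succ\<close>, so an
      injective trajectory never enters it. Along such a trajectory the stopped flow is therefore
      the original one.\<close>
    have notC: "(succ ^^ n) p \<notin> C" for n
    proof
      assume "(succ ^^ n) p \<in> C"
      then have "(succ ^^ m) ((succ ^^ n) p) \<in> C" for m
        using succC by (induction m) auto
      then have "(succ ^^ (m + n)) p \<in> C" for m
        by (simp add: funpow_add)
      then have "(\<lambda>m. (succ ^^ (m + n)) p) ` UNIV \<subseteq> C" by auto
      moreover have "inj (\<lambda>m. (succ ^^ (m + n)) p)"
        using inj[OF inf(1)] unfolding inj_def by (metis add_right_cancel)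
      ultimately show False
        using C(1) finite_subset infinite_UNIV_nat finite_imageD by metis
    qed
    have "F.succ x = succ x" if "x \<notin> C" for x
      using that by (simp add: F.succ_def succ_def)
    then have "(F.succ ^^ n) p = (succ ^^ n) p" for n
      by (induction n) (simp_all add: notC)
    then show ?thesis
      using inj[OF inf(1)] by simp
  qed simp
  have S': "finite S'" "S' \<subseteq> X" "s \<in> S'"
    using S s C by (auto simp: S'_def)
  \<comment> \<open>A flow edge lost by stopping starts in \<open>C\<close>, hence also ends there,
    and so counts as exceptional.\<close>
  have edges': "b = (if x \<in> C then \<one> else dir x) \<or>
      inv b = (if act x b \<in> C then \<one> else dir (act x b)) \<or> (x \<in> S' \<and> act x b \<in> S')"
    if "x \<in> X" "b \<in> B" for x b
  proof -
    have "act (act x b) (inv b) = x"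
      using that B by (intro act_inv) auto
    then have "x \<in> C \<Longrightarrow> b = dir x \<Longrightarrow> act x b \<in> C"
      and "act x b \<in> C \<Longrightarrow> inv b = dir (act x b) \<Longrightarrow> x \<in> C"
      using succC[of x] succC[of "act x b"] by (auto simp: succ_def)
    then show ?thesis
      using edges[OF that] unfolding S'_def by auto
  qed
  obtain Y where "finite Y" "Y \<subseteq> carrier G" "stab s = set_star G Y"
    by (rule F.stab_eq_set_star_if_finite_links[OF B gen S' edges'])
      (use stop S' in \<open>auto intro!: F.finite_links\<close>)
  then show ?thesis
    by (simp add: rational_subsets.finite rational_subsets.star)
qed

text \<open>A nonempty transporter is the product of the stabiliser with a singleton.\<close>

lemma transporter_rational:
  assumes "s \<in> X" "stab s \<in> rational_subsets G"
  shows "{g \<in> carrier G. act s g = t} \<in> rational_subsets G"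
proof (cases "\<exists>c\<in>carrier G. act s c = t")
  case True
  then obtain c where "c \<in> carrier G" "act s c = t" by blast
  then show ?thesis
    using transporter_eq_coset[OF assms(1), of c]
      rational_subsets.product[OF assms(2) rational_subsets.finite[of "{c}"]]
    by auto
next
  case False
  then have "{g \<in> carrier G. act s g = t} = {}" by auto
  then show ?thesis
    by (metis rational_subsets.finite finite.emptyI empty_subsetI)
qed

end

lemma rational_subsets_UN:
  assumes "finite I" "\<And>i. i \<in> I \<Longrightarrow> X i \<in> rational_subsets G"
  shows "(\<Union>i\<in>I. X i) \<in> rational_subsets G"
  using assms
  by (induction I rule: finite_induct) (auto intro: rational_subsets.finite rational_subsets.union)

section \<open>Reduced words\<close>

definition reduced :: "'a letter list \<Rightarrow> bool" where
  "reduced = successively (\<lambda>x y. y \<noteq> letter_inv x)"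

text \<open>Left multiplication by a letter, performed on reduced words.\<close>

fun push :: "'a letter \<Rightarrow> 'a letter list \<Rightarrow> 'a letter list" where
  "push x [] = [x]"
| "push x (y # w) = (if y = letter_inv x then w else x # y # w)"

lemma reduced_Nil [simp]: "reduced []"
  by (simp add: reduced_def)

lemma reduced_Cons: "reduced (x # w) \<longleftrightarrow> reduced w \<and> (w = [] \<or> hd w \<noteq> letter_inv x)"
  by (cases w) (auto simp: reduced_def)

lemma reduced_snoc: "reduced (w @ [x]) \<longleftrightarrow> reduced w \<and> (w = [] \<or> x \<noteq> letter_inv (last w))"
  by (auto simp: reduced_def successively_append_iff)

lemma reduced_push: "reduced w \<Longrightarrow> reduced (push x w)"
  by (cases w) (auto simp: reduced_Cons)

text \<open>Reducedness matters: if \<open>w\<close> began with \<open>x\<close> followed by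
  \<open>letter_inv x\<close>, both pushes would cancel.\<close>

lemma push_push_inv: "reduced w \<Longrightarrow> push x (push (letter_inv x) w) = w"
  by (cases w rule: list.exhaust[case_product list.exhaust[of "tl w"]])
    (auto simp: reduced_Cons neq_Nil_conv)

lemma reduced_foldr_push: "reduced w \<Longrightarrow> reduced (foldr push u w)"
  by (induction u) (auto simp: reduced_push)

lemma foldr_push_reduced: "reduced u \<Longrightarrow> foldr push u [] = u"
proof (induction u)
  case (Cons x u)
  then show ?case by (cases u) (auto simp: reduced_Cons)
qed simp

text \<open>Van der Waerden's argument: letters act on reduced words by permutations, inverse
  letters by the inverse permutations, so congruent words act alike.\<close>

lemma foldr_push_cong:
  "(u, v) \<in> free_cong A \<Longrightarrow> reduced w \<Longrightarrow> foldr push u w = foldr push v w"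
  by (induction arbitrary: w rule: free_cong.induct) (auto simp: push_push_inv reduced_foldr_push)

text \<open>A reduced word acting on the empty word reproduces itself.\<close>

lemma reduced_unique: "(u, v) \<in> free_cong A \<Longrightarrow> reduced u \<Longrightarrow> reduced v \<Longrightarrow> u = v"
  using foldr_push_cong[of u v A "[]"] by (simp add: foldr_push_reduced)

lemma reduced_exists:
  assumes "u \<in> words A"
  shows "\<exists>r\<in>words A. reduced r \<and> (u, r) \<in> free_cong A"
  using assms
proof (induction u)
  case Nil
  then show ?case by (intro bexI[of _ "[]"]) (auto intro: free_cong.refl)
next
  case (Cons x u)
  then obtain r where r: "r \<in> words A" "reduced r" "(u, r) \<in> free_cong A" and x: "x \<in> letters A"
    by auto
  have xr: "(x # u, x # r) \<in> free_cong A"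
    using free_cong.append[OF free_cong.refl[of "[x]"] r(3)] x by simp
  show ?case
  proof (cases "reduced (x # r)")
    case False
    then obtain r' where r': "r = letter_inv x # r'"
      using r by (cases r) (auto simp: reduced_Cons)
    have "(x # r, r') \<in> free_cong A"
      using free_cong.append[OF free_cong.cancel[OF x] free_cong.refl[of r']] r(1) r' by simp
    then show ?thesis
      using r r' free_cong.trans[OF xr] by (intro bexI[of _ r']) (auto simp: reduced_Cons)
  qed (use r x xr in auto)
qed

text \<open>Each letter multiplied on the right of a reduced word changes only its last letter.\<close>

lemma reduced_append_prefix:
  assumes "r \<in> words A" "reduced r" "w \<in> words A"
  shows "\<exists>r'\<in>words A. reduced r' \<and> (r @ w, r') \<in> free_cong A \<and>
    take (length r - length w) r' = take (length r - length w) r \<and>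
    length r \<le> length r' + length w"
  using assms(3)
proof (induction w rule: rev_induct)
  case Nil
  then show ?case using assms by (intro bexI[of _ r]) (auto intro: free_cong.refl)
next
  case (snoc x w)
  then obtain r' where r': "r' \<in> words A" "reduced r'" "(r @ w, r') \<in> free_cong A"
    "take (length r - length w) r' = take (length r - length w) r"
    "length r \<le> length r' + length w" and x: "x \<in> letters A"
    by auto
  have c: "(r @ w @ [x], r' @ [x]) \<in> free_cong A"
    using free_cong.append[OF r'(3) free_cong.refl[of "[x]"]] x by simp
  \<comment> \<open>The protected prefix shrinks by one for each letter of the right factor.\<close>
  have t: "take (length r - Suc (length w)) r' = take (length r - Suc (length w)) r"
    using arg_cong[OF r'(4), of "take (length r - Suc (length w))"]
    by (simp add: min_absorb1)
  show ?case
  proof (cases "reduced (r' @ [x])")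
    case True
    then show ?thesis
      using r' x c t by (intro bexI[of _ "r' @ [x]"]) auto
  next
    case False
    then have ne: "r' \<noteq> []" and xl: "x = letter_inv (last r')"
      using r'(2) by (auto simp: reduced_snoc)
    \<comment> \<open>The length bound on \<open>r'\<close> keeps the cancelled last letter outside
      the protected prefix.\<close>
    define v where "v = butlast r'"
    have v: "r' = v @ [letter_inv x]"
      using ne xl by (simp add: v_def)
    have "([letter_inv x, x], []) \<in> free_cong A"
      using free_cong.cancel[of "letter_inv x" A] x by simp
    then have "(r' @ [x], v) \<in> free_cong A"
      using free_cong.append[OF free_cong.refl[of v]] r'(1) v by fastforce
    then show ?thesis
      using r' t v free_cong.trans[OF c] by (intro bexI[of _ v]) (auto simp: reduced_snoc)
  qed
qed

section \<open>The action defined by an inverse transducer\<close>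

definition normal_form :: "'a set \<Rightarrow> 'a letter list set \<Rightarrow> 'a letter list" where
  "normal_form A g = (SOME r. r \<in> words A \<and> reduced r \<and> theta A r = g)"

lemma normal_form:
  assumes "g \<in> carrier (free_group A)"
  shows "normal_form A g \<in> words A" "reduced (normal_form A g)" "theta A (normal_form A g) = g"
proof -
  obtain u where u: "u \<in> words A" "g = theta A u"
    using assms by (auto simp: carrier_free_group)
  then have "\<exists>r. r \<in> words A \<and> reduced r \<and> theta A r = g"
    using reduced_exists[OF u(1)] by (metis theta_eq_iff)
  from someI_ex[OF this]
  show "normal_form A g \<in> words A" "reduced (normal_form A g)" "theta A (normal_form A g) = g"
    by (auto simp: normal_form_def)
qed

lemma normal_form_theta:
  assumes "r \<in> words A" "reduced r"
  shows "normal_form A (theta A r) = r"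
  using assms normal_form[of "theta A r" A]
  by (metis carrier_free_group imageI reduced_unique theta_eq_iff)

lemma theta_closed [simp]: "u \<in> words A \<Longrightarrow> theta A u \<in> carrier (free_group A)"
  by (simp add: carrier_free_group)

lemma theta_inv:
  assumes "u \<in> words A"
  shows "inv\<^bsub>free_group A\<^esub> (theta A u) = theta A (word_inv u)"
proof -
  interpret group "free_group A" by (rule group_free_group)
  have "theta A u \<otimes>\<^bsub>free_group A\<^esub> theta A (word_inv u) = \<one>\<^bsub>free_group A\<^esub>"
    using assms free_cong_word_inv[OF assms] by (simp add: theta_mult theta_one theta_eq_iff)
  then show ?thesis
    using assms by (metis inv_equality inv_inv inv_closed theta_closed words_word_inv)
qed

text \<open>The reduced representative of \<open>g\<close> is only a choice of word to read;
  \<open>transducer_act_theta\<close> shows that any representative gives the same value.\<close>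

definition transducer_act ::
  "'a set \<Rightarrow> ('q, 'a) transducer \<Rightarrow> 'a letter list set \<times> 'q \<Rightarrow> 'a letter list set
    \<Rightarrow> 'a letter list set \<times> 'q" where
  "transducer_act A T x g =
    (inv\<^bsub>free_group A\<^esub> g \<otimes>\<^bsub>free_group A\<^esub> fst x
      \<otimes>\<^bsub>free_group A\<^esub> theta A (outs T (snd x) (normal_form A g)),
     steps T (snd x) (normal_form A g))"

text \<open>Since \<open>take 1\<close> of the empty word is empty, the identity gets the identity
  as direction and becomes a rest point.\<close>

definition first_letter :: "'a set \<Rightarrow> 'a letter list set \<Rightarrow> 'a letter list set" where
  "first_letter A h = theta A (take 1 (normal_form A h))"

context
  fixes A :: "'a set" and T :: "('q, 'a) transducer"
  assumes inv_T: "inverse_transducer A T"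
begin

private abbreviation (input) "F \<equiv> free_group A"
private abbreviation (input) "X \<equiv> carrier F \<times> states T"

interpretation F: group F by (rule group_free_group)

lemma transducer_act_theta:
  assumes "q \<in> states T" "u \<in> words A"
  shows "transducer_act A T (h, q) (theta A u) =
    (inv\<^bsub>F\<^esub> (theta A u) \<otimes>\<^bsub>F\<^esub> h \<otimes>\<^bsub>F\<^esub> theta A (outs T q u), steps T q u)"
proof -
  let ?n = "normal_form A (theta A u)"
  have n: "?n \<in> words A" "theta A ?n = theta A u"
    using normal_form[of "theta A u" A] assms by auto
  then have "(?n, u) \<in> free_cong A"
    using assms by (simp add: theta_eq_iff)
  from free_cong_transducer[OF inv_T this assms(1)]
  have "steps T q ?n = steps T q u" "theta A (outs T q ?n) = theta A (outs T q u)"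
    unfolding theta_def using equiv_class_eq[OF equiv_free_cong] by auto
  then show ?thesis
    by (simp add: transducer_act_def)
qed

lemma steps_outs_states_words:
  assumes "q \<in> states T" "u \<in> words A"
  shows "steps T q u \<in> states T" "outs T q u \<in> words A"
  using steps_outs_closed[of A T q u] assms inv_T by (auto simp: inverse_transducer_def)

text \<open>Output is a cocycle: by \<open>outs_append\<close> the output of \<open>u\<close> is
  absorbed into the first coordinate before \<open>v\<close> is read from the new state. Left
  multiplication by inverses reverses products, which makes this a right action.\<close>

lemma right_action_transducer: "right_action F X (transducer_act A T)"
proof unfold_locales
  fix x g assume x: "x \<in> X" and g: "g \<in> carrier F"
  obtain h q where hq: "x = (h, q)" "h \<in> carrier F" "q \<in> states T" using x by auto
  obtain u where u: "u \<in> words A" "g = theta A u" using g by (auto simp: carrier_free_group)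
  show "transducer_act A T x g \<in> X"
    using hq u by (simp add: transducer_act_theta steps_outs_states_words)
  fix g' assume "g' \<in> carrier F"
  then obtain v where v: "v \<in> words A" "g' = theta A v" by (auto simp: carrier_free_group)
  have "transducer_act A T x (g \<otimes>\<^bsub>F\<^esub> g') = transducer_act A T (h, q) (theta A (u @ v))"
    using u v hq by (simp add: theta_mult)
  also have "\<dots> = (inv\<^bsub>F\<^esub> (theta A u \<otimes>\<^bsub>F\<^esub> theta A v) \<otimes>\<^bsub>F\<^esub> h \<otimes>\<^bsub>F\<^esub>
      (theta A (outs T q u) \<otimes>\<^bsub>F\<^esub> theta A (outs T (steps T q u) v)), steps T (steps T q u) v)"
    using u v hq
    by (simp add: transducer_act_theta theta_mult steps_append outs_append steps_outs_states_words)
  also have "\<dots> = transducer_act A T (transducer_act A T x g) g'"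
    using u v hq
    by (simp add: transducer_act_theta steps_outs_states_words F.inv_mult_group F.m_assoc)
  finally show "transducer_act A T x (g \<otimes>\<^bsub>F\<^esub> g') =
    transducer_act A T (transducer_act A T x g) g'" .
next
  fix x assume "x \<in> X"
  then obtain h q where hq: "x = (h, q)" "h \<in> carrier F" "q \<in> states T" by auto
  have "theta A [] = \<one>\<^bsub>F\<^esub>" by (simp add: theta_one)
  then show "transducer_act A T x \<one>\<^bsub>F\<^esub> = x"
    using transducer_act_theta[of q "[]" h] hq by (simp add: steps_def)
qed

lemma flow_transducer: "flow F X (transducer_act A T) (\<lambda>x. first_letter A (fst x))"
proof -
  have "take 1 (normal_form A h) \<in> words A" if "h \<in> carrier F" for h
    using normal_form(1)[OF that] by (metis append_take_drop_id words_append)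
  then show ?thesis
    by (intro flow.intro right_action_transducer flow_axioms.intro)
      (auto simp: first_letter_def)
qed

text \<open>If \<open>x\<close> does not cancel against \<open>h\<close>, then \<open>x\<^sup>-\<^sup>1 h\<close> is reduced as written, and a short output
  cannot erase its first letter.\<close>

lemma first_letter_cases:
  assumes x: "x \<in> letters A" and h: "h \<in> carrier F" and q: "q \<in> states T"
    and long: "length (out T q x) \<le> length (normal_form A h)"
  shows "theta A [x] = first_letter A h \<or>
    inv\<^bsub>F\<^esub> (theta A [x]) = first_letter A (fst (transducer_act A T (h, q) (theta A [x])))"
proof (cases "reduced (letter_inv x # normal_form A h)")
  case True
  let ?r = "letter_inv x # normal_form A h" and ?w = "out T q x"
  note n = normal_form[OF h]
  have w: "?w \<in> words A" using steps_outs_states_words(2)[OF q, of "[x]"] x by simp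
  have r: "?r \<in> words A" using n x by simp
  obtain r' where r': "r' \<in> words A" "reduced r'" "(?r @ ?w, r') \<in> free_cong A"
    "take (length ?r - length ?w) r' = take (length ?r - length ?w) ?r"
    using reduced_append_prefix[OF r True w] by blast
  \<comment> \<open>\<open>?r\<close> is one letter longer than the normal form of \<open>h\<close>,
    so \<open>long\<close> leaves at least one protected letter.\<close>
  have "take 1 r' = take 1 ?r"
    using arg_cong[OF r'(4), of "take 1"] long by (simp add: min_def Suc_diff_le)
  then have t: "take 1 r' = [letter_inv x]" by simp
  have i: "inv\<^bsub>F\<^esub> (theta A [x]) = theta A [letter_inv x]"
    using x by (simp add: theta_inv word_inv_def)
  have "fst (transducer_act A T (h, q) (theta A [x])) =
      theta A [letter_inv x] \<otimes>\<^bsub>F\<^esub> theta A (normal_form A h) \<otimes>\<^bsub>F\<^esub> theta A ?w"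
    using x q n by (simp add: transducer_act_theta i)
  also have "\<dots> = theta A r'"
    using x n(1) w r' by (simp add: theta_mult theta_eq_iff)
  finally show ?thesis
    using r' t i by (simp add: first_letter_def normal_form_theta)
next
  case False
  \<comment> \<open>Failure of reducedness means that the normal form of \<open>h\<close> begins
    with \<open>x\<close>.\<close>
  then show ?thesis
    using normal_form[OF h] by (cases "normal_form A h") (auto simp: reduced_Cons first_letter_def)
qed

lemma stab_transducer_rational:
  assumes fin: "finite A" "finite (states T)" and s: "s \<in> X"
  shows "right_action.stab F (transducer_act A T) s \<in> rational_subsets F"
proof -
  interpret flow F X "transducer_act A T" "\<lambda>x. first_letter A (fst x)"
    by (rule flow_transducer)
  have finl: "finite (letters A)" using fin by (simp add: letters_def)
  define B where "B = (\<lambda>x. theta A [x]) ` letters A"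
  have B: "finite B" "B \<subseteq> carrier F" using finl by (auto simp: B_def)
  \<comment> \<open>Bound on the output of a single letter; for empty \<open>A\<close> its value is
    arbitrary, but then there is no letter to bound.\<close>
  define M where "M = Max ((\<lambda>(q, x). length (out T q x)) ` (states T \<times> letters A))"
  have M: "length (out T q x) \<le> M" if "q \<in> states T" "x \<in> letters A" for q x
    unfolding M_def using that fin finl by (intro Max_ge) force+
  \<comment> \<open>Outside \<open>E\<close> the normal form of \<open>h\<close> is longer than
    \<open>M\<close>, so \<open>first_letter_cases\<close> applies.\<close>
  define E where "E = (theta A ` {u \<in> words A. length u \<le> M}) \<times> states T"
  have "finite {u \<in> words A. length u \<le> M}"
    using finite_lists_length_le[OF finl] by (simp add: words_def lists_eq_set)
  then have E: "finite E" "E \<subseteq> X" using fin by (auto simp: E_def)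
  \<comment> \<open>Neighbours of \<open>E\<close> are added because both ends of an exceptional
    edge must lie in \<open>S\<close>.\<close>
  define S where "S = E \<union> (\<lambda>(x, b). transducer_act A T x b) ` (E \<times> B)"
  have S: "finite S"
    using E B by (simp add: S_def)
  have "transducer_act A T x b \<in> X" if "x \<in> E" "b \<in> B" for x b
    using that E(2) B(2) by (intro act_closed) auto
  then have SX: "S \<subseteq> X"
    using E(2) unfolding S_def by (simp only: Un_subset_iff image_subset_iff) auto
  show ?thesis
  proof (rule stab_rational[OF B _ S SX _ s])
    show "carrier F \<subseteq> set_star F B"
    proof
      fix g assume "g \<in> carrier F"
      then obtain u where "u \<in> words A" "g = theta A u" by (auto simp: carrier_free_group)
      moreover from this(1) have "theta A u \<in> set_star F B"
      proof (induction u rule: rev_induct)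
        case Nil
        then show ?case using F.set_star_one[of B] by (simp add: theta_one)
      next
        case (snoc x u)
        then show ?case
          using F.set_star_mult[of "theta A u" B "theta A [x]"] by (simp add: theta_mult B_def)
      qed
      ultimately show "g \<in> set_star F B" by simp
    qed
  next
    fix y b assume y: "y \<in> X" and b: "b \<in> B"
    obtain h q where hq: "y = (h, q)" "h \<in> carrier F" "q \<in> states T" using y by auto
    obtain x where x: "x \<in> letters A" "b = theta A [x]" using b by (auto simp: B_def)
    show "b = first_letter A (fst y) \<or>
      inv\<^bsub>F\<^esub> b = first_letter A (fst (transducer_act A T y b)) \<or>
      y \<in> S \<and> transducer_act A T y b \<in> S"
    proof (cases "length (normal_form A h) \<le> M")
      case True
      then have "y \<in> E"
        using normal_form[OF hq(2)] hq by (force simp: E_def)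
      then show ?thesis using b by (force simp: S_def)
    next
      case False
      then show ?thesis
        using first_letter_cases[OF x(1) hq(2,3)] M[OF hq(3) x(1)] x hq by auto
    qed
  qed
qed

text \<open>Moving \<open>g\<close> to the other side turns the equation into a condition on the
  first coordinate of the image of the base point; the final state is left free.\<close>

lemma transducer_act_start:
  assumes g: "g \<in> carrier F" and z: "z \<in> carrier F"
  shows "group_map A T g = g \<otimes>\<^bsub>F\<^esub> z \<longleftrightarrow>
    (\<exists>q\<in>states T. transducer_act A T (\<one>\<^bsub>F\<^esub>, start T) g = (z, q))"
proof -
  obtain u where u: "u \<in> words A" "g = theta A u" using g by (auto simp: carrier_free_group)
  have st: "start T \<in> states T" using inv_T by (simp add: inverse_transducer_def transducer_def)
  note cl = steps_outs_states_words[OF st u(1)]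
  have "group_map A T g = theta A (outs T (start T) u)"
    using group_map_theta[OF inv_T u(1)] u by (simp add: word_map_def)
  moreover have "transducer_act A T (\<one>\<^bsub>F\<^esub>, start T) g =
      (inv\<^bsub>F\<^esub> g \<otimes>\<^bsub>F\<^esub> theta A (outs T (start T) u), steps T (start T) u)"
    using transducer_act_theta[OF st u(1), of "\<one>\<^bsub>F\<^esub>"] u g by simp
  ultimately show ?thesis
    using cl g z by (auto simp: F.inv_solve_left')
qed

end

theorem theorem3p2:
  fixes A :: "'a set" and T :: "('q, 'a) transducer" and z :: "'a letter list set"
  assumes "finite A"
    and "inverse_transducer A T"
    and "finite (states T)"
    and "z \<in> carrier (free_group A)"
  shows "{g \<in> carrier (free_group A). group_map A T g = g \<otimes>\<^bsub>free_group A\<^esub> z}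
    \<in> rational_subsets (free_group A)"
proof -
  let ?F = "free_group A" and ?act = "transducer_act A T"
  interpret flow ?F "carrier ?F \<times> states T" ?act "\<lambda>x. first_letter A (fst x)"
    by (rule flow_transducer[OF assms(2)])
  let ?s = "(\<one>\<^bsub>?F\<^esub>, start T)"
  have s: "?s \<in> carrier ?F \<times> states T"
    using assms(2) by (simp add: inverse_transducer_def transducer_def)
  \<comment> \<open>Sorting the solutions by final state gives one transporter for each of the
    finitely many states.\<close>
  have "{g \<in> carrier ?F. group_map A T g = g \<otimes>\<^bsub>?F\<^esub> z} =
      (\<Union>q\<in>states T. {g \<in> carrier ?F. ?act ?s g = (z, q)})"
    using transducer_act_start[OF assms(2) _ assms(4)] by auto
  then show ?thesis
    using stab_transducer_rational[OF assms(2,1,3) s] assms(3)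
    by (simp only:) (intro rational_subsets_UN transporter_rational s)
qed

end
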